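(* Let $f_1,\dots,f_k$ be Boolean functions on finite sets $X_1,\dots,X_k\subset\mathbb{R}^n$, respectively, with $f_i\not\equiv 1$ for each $i$. Let $d=\deg_{\pm}(f_1\wedge f_2\wedge\cdots\wedge f_k)$. Then \[\sum_{i=1}^kR^+(f_i,D)<1\quad\text{for }D=8d\log 2k.\]
   Context: Boolean values: $-1$ is true, $+1$ false. $f_1\wedge\cdots\wedge f_k$ is the function $(x_1,\dots,x_k)\mapsto f_1(x_1)\wedge\cdots\wedge f_k(x_k)$ on $X_1\times\cdots\times X_k$. The threshold degree $\deg_{\pm}(h)$ is the least total degree of a real polynomial $p$ with $h(z)p(z)>0$ on the domain. $R^+(f,D)=\inf_{p,q}\sup_{x}|f(x)-p(x)/q(x)|$ over real polynomials $p,q$ of total degree at most $D$ with $q$ positive on the domain of $f$. $\log$ is to base $2$. *)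

theory Defs
  imports "HOL-Analysis.Analysis"
begin

text \<open>
  Real polynomials (as functions) of total degree at most \<open>D\<close> in the coordinates of a Euclidean
  space. A multi-index assigns an exponent to each basis vector; the bound \<open>D\<close> is a real number,
  since degree bounds such as \<open>8 * d * log 2 (2 * k)\<close> need not be integers.
\<close>

definition multi_indices :: "real \<Rightarrow> ('a::euclidean_space \<Rightarrow> nat) set" where
  "multi_indices D = {\<alpha> \<in> Basis \<rightarrow>\<^sub>E UNIV. real (\<Sum>b\<in>Basis. \<alpha> b) \<le> D}"

lemma finite_multi_indices: "finite (multi_indices D :: ('a::euclidean_space \<Rightarrow> nat) set)"
proof (rule finite_subset)
  show "multi_indices D \<subseteq> ((Basis::'a set) \<rightarrow>\<^sub>E {..nat \<lfloor>D\<rfloor>})"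
  proof
    fix \<alpha> :: "'a \<Rightarrow> nat" assume A: "\<alpha> \<in> multi_indices D"
    have "\<alpha> b \<le> nat \<lfloor>D\<rfloor>" if "b \<in> Basis" for b
    proof -
      have "\<alpha> b \<le> (\<Sum>b\<in>Basis. \<alpha> b)"
        using that by (intro member_le_sum) auto
      moreover have "real (\<Sum>b\<in>Basis. \<alpha> b) \<le> D"
        using A by (simp add: multi_indices_def)
      ultimately have "real (\<alpha> b) \<le> D"
        by (meson of_nat_le_iff order_trans)
      then show ?thesis by (simp add: le_nat_floor)
    qed
    with A show "\<alpha> \<in> Basis \<rightarrow>\<^sub>E {..nat \<lfloor>D\<rfloor>}"
      by (auto simp: multi_indices_def PiE_def)
  qed
qed (auto intro: finite_PiE)

definition polynomials_le :: "real \<Rightarrow> ('a::euclidean_space \<Rightarrow> real) set" where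
  "polynomials_le D =
     {p. \<exists>c. p = (\<lambda>x. \<Sum>\<alpha>\<in>multi_indices D. c \<alpha> * (\<Prod>b\<in>Basis. (x \<bullet> b) ^ \<alpha> b))}"

definition threshold_degree :: "'a::euclidean_space set \<Rightarrow> ('a \<Rightarrow> real) \<Rightarrow> nat" where
  "threshold_degree Z h =
     (LEAST d. \<exists>p \<in> polynomials_le (real d). \<forall>z\<in>Z. h z * p z > 0)"

definition rational_approx_error :: "'a::euclidean_space set \<Rightarrow> ('a \<Rightarrow> real) \<Rightarrow> real \<Rightarrow> real" where
  "rational_approx_error X f D =
     Inf {SUP x\<in>X. \<bar>f x - p x / q x\<bar> | p q.
            p \<in> polynomials_le D \<and> q \<in> polynomials_le D \<and> (\<forall>x\<in>X. q x > 0)}"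

text \<open>Boolean values are encoded as \<open>-1\<close> (true) and \<open>1\<close> (false).\<close>

definition conjunction :: "('k::finite \<Rightarrow> 'a \<Rightarrow> real) \<Rightarrow> 'a ^ 'k \<Rightarrow> real" where
  "conjunction f z = (if \<forall>i. f i (z $ i) = -1 then -1 else 1)"

end

theory Submission
  imports Defs
begin

text \<open>
  For two functions \<open>f\<close>, \<open>g\<close>, let \<open>P\<close> have degree \<open>d\<close>, positive where both are true and negative
  elsewhere. For positive weights \<open>\<theta>\<close> on \<open>Y\<close>, the sum of \<open>\<theta> y * P x y\<close> over the true points \<open>y\<close>
  of \<open>g\<close> has the sign of \<open>- f x\<close>, while the sum over the false points is always negative. If the
  moduli \<open>N\<close>, \<open>M\<close> of these sums agree up to a factor \<open>s\<close> on \<open>X\<close>, then \<open>2 N M / (N\<^sup>2 + M\<^sup>2)\<close>, with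
  the proper sign, approximates \<open>f\<close> within \<open>1 - 2 s / (1 + s\<^sup>2)\<close>. If no weights achieve this, linear
  programming duality provides weights on \<open>X\<close> that approximate \<open>g\<close> within \<open>2 / s\<^sup>2\<close>. At the critical
  value of \<open>s\<close> the two errors add up to less than \<open>1\<close> unless \<open>s\<close> is small, in which case the error
  for \<open>f\<close> is below \<open>1/2\<close>; exchanging \<open>f\<close> and \<open>g\<close> settles that case.

  For \<open>k\<close> functions, fixing all but two coordinates at true points shows that any two errors at degree
  \<open>2 d\<close> add up to less than \<open>1\<close>. So at most one error is \<open>1 - \<delta> \<ge> 1/2\<close> and the others are below
  \<open>\<delta>\<close>. Iterating \<open>r \<mapsto> 2 r / (1 + r\<^sup>2)\<close>, which squares the error and doubles the degree, brings
  these down to \<open>\<delta> / k\<close>.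
\<close>

section \<open>Polynomials of bounded degree\<close>

lemma polynomials_le_add:
  assumes "p \<in> polynomials_le D" "q \<in> polynomials_le D"
  shows "(\<lambda>x. p x + q x) \<in> polynomials_le D"
proof -
  obtain c c' where
    "p = (\<lambda>x. \<Sum>\<alpha>\<in>multi_indices D. c \<alpha> * (\<Prod>b\<in>Basis. (x \<bullet> b) ^ \<alpha> b))"
    "q = (\<lambda>x. \<Sum>\<alpha>\<in>multi_indices D. c' \<alpha> * (\<Prod>b\<in>Basis. (x \<bullet> b) ^ \<alpha> b))"
    using assms unfolding polynomials_le_def by blast
  then have "(\<lambda>x. p x + q x)
      = (\<lambda>x. \<Sum>\<alpha>\<in>multi_indices D. (c \<alpha> + c' \<alpha>) * (\<Prod>b\<in>Basis. (x \<bullet> b) ^ \<alpha> b))"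
    by (simp add: sum.distrib distrib_right)
  then show ?thesis unfolding polynomials_le_def mem_Collect_eq
    by (rule exI[of _ "\<lambda>\<alpha>. c \<alpha> + c' \<alpha>"])
qed

lemma polynomials_le_cmult:
  assumes "p \<in> polynomials_le D"
  shows "(\<lambda>x. a * p x) \<in> polynomials_le D"
proof -
  obtain c where "p = (\<lambda>x. \<Sum>\<alpha>\<in>multi_indices D. c \<alpha> * (\<Prod>b\<in>Basis. (x \<bullet> b) ^ \<alpha> b))"
    using assms unfolding polynomials_le_def by blast
  then have "(\<lambda>x. a * p x)
      = (\<lambda>x. \<Sum>\<alpha>\<in>multi_indices D. (a * c \<alpha>) * (\<Prod>b\<in>Basis. (x \<bullet> b) ^ \<alpha> b))"
    by (simp add: sum_distrib_left mult.assoc)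
  then show ?thesis unfolding polynomials_le_def mem_Collect_eq
    by (rule exI[of _ "\<lambda>\<alpha>. a * c \<alpha>"])
qed

lemma polynomials_le_zero: "(\<lambda>x. 0) \<in> polynomials_le D"
  unfolding polynomials_le_def by (auto intro!: exI[of _ "\<lambda>_. 0"])

lemma polynomials_le_uminus:
  "p \<in> polynomials_le D \<Longrightarrow> (\<lambda>x. - p x) \<in> polynomials_le D"
  using polynomials_le_cmult[of p D "-1"] by simp

lemma polynomials_le_diff:
  "p \<in> polynomials_le D \<Longrightarrow> q \<in> polynomials_le D \<Longrightarrow> (\<lambda>x. p x - q x) \<in> polynomials_le D"
  using polynomials_le_add[OF _ polynomials_le_uminus, of p D q] by simp

lemma polynomials_le_sum:
  "(\<And>i. i \<in> I \<Longrightarrow> p i \<in> polynomials_le D) \<Longrightarrow> (\<lambda>x. \<Sum>i\<in>I. p i x) \<in> polynomials_le D"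
  by (induction I rule: infinite_finite_induct) (auto intro: polynomials_le_zero polynomials_le_add)

lemma polynomials_le_monomial:
  fixes \<alpha> :: "'a::euclidean_space \<Rightarrow> nat"
  assumes "real (\<Sum>b\<in>Basis. \<alpha> b) \<le> D"
  shows "(\<lambda>x. \<Prod>b\<in>Basis. (x \<bullet> b) ^ \<alpha> b) \<in> polynomials_le D"
proof -
  \<comment> \<open>Members of \<open>multi_indices\<close> are extensional, so the exponents
    outside \<open>Basis\<close>, which the monomial ignores, have to be reset.\<close>
  define \<alpha>' where "\<alpha>' = restrict \<alpha> Basis"
  have "\<alpha>' \<in> multi_indices D"
    using assms by (auto simp: multi_indices_def \<alpha>'_def)
  then have "(\<Sum>\<beta>\<in>multi_indices D. (if \<beta> = \<alpha>' then 1 else 0) * (\<Prod>b\<in>Basis. (x \<bullet> b) ^ \<beta> b))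
      = (\<Prod>b\<in>Basis. (x \<bullet> b) ^ \<alpha> b)" for x :: 'a
    by (simp add: finite_multi_indices if_distrib[of "\<lambda>t. t * _"] sum.delta \<alpha>'_def cong: if_cong)
  then show ?thesis
    unfolding polynomials_le_def by (auto intro!: exI[of _ "\<lambda>\<beta>. if \<beta> = \<alpha>' then 1 else 0"])
qed

lemma polynomials_le_mono:
  assumes "p \<in> polynomials_le D" "D \<le> E"
  shows "p \<in> polynomials_le E"
proof -
  obtain c where p: "p = (\<lambda>x. \<Sum>\<alpha>\<in>multi_indices D. c \<alpha> * (\<Prod>b\<in>Basis. (x \<bullet> b) ^ \<alpha> b))"
    using assms unfolding polynomials_le_def by blast
  show ?thesis unfolding p
    by (intro polynomials_le_sum polynomials_le_cmult polynomials_le_monomial)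
       (use assms(2) in \<open>simp add: multi_indices_def\<close>)
qed

lemma polynomials_le_const: "0 \<le> D \<Longrightarrow> (\<lambda>x. a) \<in> polynomials_le D"
  using polynomials_le_cmult[OF polynomials_le_monomial[of "\<lambda>_. 0" D], of a] by simp

lemma polynomials_le_coordinate:
  assumes "b \<in> Basis" "1 \<le> D"
  shows "(\<lambda>x. x \<bullet> b) \<in> polynomials_le D"
proof -
  have "(\<lambda>x::'a. \<Prod>b'\<in>Basis. (x \<bullet> b') ^ (if b' = b then 1 else 0)) \<in> polynomials_le D"
    using assms by (intro polynomials_le_monomial) simp
  moreover have "(\<Prod>b'\<in>Basis. (x \<bullet> b') ^ (if b' = b then 1 else 0)) = x \<bullet> b" for x :: 'a
    using assms by (simp add: if_distrib[of "\<lambda>t. _ ^ t"] prod.delta cong: if_cong)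
  ultimately show ?thesis by simp
qed

lemma polynomials_le_mult:
  assumes "p \<in> polynomials_le D" "q \<in> polynomials_le E"
  shows "(\<lambda>x. p x * q x) \<in> polynomials_le (D + E)"
proof -
  obtain c c' where
    p: "p = (\<lambda>x. \<Sum>\<alpha>\<in>multi_indices D. c \<alpha> * (\<Prod>b\<in>Basis. (x \<bullet> b) ^ \<alpha> b))" and
    q: "q = (\<lambda>x. \<Sum>\<beta>\<in>multi_indices E. c' \<beta> * (\<Prod>b\<in>Basis. (x \<bullet> b) ^ \<beta> b))"
    using assms unfolding polynomials_le_def by blast
  have "(\<lambda>x. p x * q x) = (\<lambda>x. \<Sum>\<alpha>\<in>multi_indices D. \<Sum>\<beta>\<in>multi_indices E.
          c \<alpha> * c' \<beta> * (\<Prod>b\<in>Basis. (x \<bullet> b) ^ (\<alpha> b + \<beta> b)))"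
    unfolding p q sum_product by (intro ext sum.cong refl) (simp add: power_add prod.distrib)
  also have "\<dots> \<in> polynomials_le (D + E)"
    by (intro polynomials_le_sum polynomials_le_cmult polynomials_le_monomial)
       (auto simp: multi_indices_def sum.distrib)
  finally show ?thesis .
qed

lemma polynomials_le_mult2:
  "p \<in> polynomials_le D \<Longrightarrow> q \<in> polynomials_le D \<Longrightarrow> (\<lambda>x. p x * q x) \<in> polynomials_le (2 * D)"
  using polynomials_le_mult[of p D q D] by simp

lemma polynomials_le_prod:
  assumes "\<And>i. i \<in> I \<Longrightarrow> p i \<in> polynomials_le (D i)"
  shows "(\<lambda>x. \<Prod>i\<in>I. p i x) \<in> polynomials_le (\<Sum>i\<in>I. D i)"
  using assms
  by (induction I rule: infinite_finite_induct) (auto intro: polynomials_le_const polynomials_le_mult)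

lemma polynomials_le_power:
  "p \<in> polynomials_le D \<Longrightarrow> (\<lambda>x. p x ^ n) \<in> polynomials_le (real n * D)"
  using polynomials_le_prod[of "{..<n}" "\<lambda>_. p" "\<lambda>_. D"] by simp

lemma polynomials_le_affine_substitution:
  fixes \<phi> :: "'a::euclidean_space \<Rightarrow> 'b::euclidean_space"
  assumes "p \<in> polynomials_le D" and "\<And>b. b \<in> Basis \<Longrightarrow> (\<lambda>x. \<phi> x \<bullet> b) \<in> polynomials_le 1"
  shows "(\<lambda>x. p (\<phi> x)) \<in> polynomials_le D"
proof -
  obtain c where p: "p = (\<lambda>x. \<Sum>\<alpha>\<in>multi_indices D. c \<alpha> * (\<Prod>b\<in>Basis. (x \<bullet> b) ^ \<alpha> b))"
    using assms unfolding polynomials_le_def by blast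
  have "(\<lambda>x. \<Prod>b\<in>Basis. (\<phi> x \<bullet> b) ^ \<alpha> b) \<in> polynomials_le D" if "\<alpha> \<in> multi_indices D" for \<alpha>
  proof (rule polynomials_le_mono)
    show "(\<lambda>x. \<Prod>b\<in>Basis. (\<phi> x \<bullet> b) ^ \<alpha> b) \<in> polynomials_le (\<Sum>b\<in>Basis. real (\<alpha> b) * 1)"
      using assms(2) by (intro polynomials_le_prod polynomials_le_power)
    show "(\<Sum>b\<in>Basis. real (\<alpha> b) * 1) \<le> D"
      using that by (simp add: multi_indices_def)
  qed
  then show ?thesis unfolding p
    by (intro polynomials_le_sum polynomials_le_cmult)
qed

text \<open>Freezing all coordinates but one is an affine substitution. This is how a sign
  representation of the whole conjunction is restricted to a single function.\<close>

lemma polynomials_le_slice: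
  fixes p :: "(real ^ 'n) ^ 'k \<Rightarrow> real"
  assumes "p \<in> polynomials_le D"
  shows "(\<lambda>x. p (\<chi> l. if l = i then x else a l)) \<in> polynomials_le D"
proof (rule polynomials_le_affine_substitution[OF assms])
  fix b :: "(real ^ 'n) ^ 'k" assume "b \<in> Basis"
  then obtain l c where b: "b = axis l c" "c \<in> Basis" by (auto simp: Basis_vec_def)
  show "(\<lambda>x. (\<chi> l. if l = i then x else a l) \<bullet> b) \<in> polynomials_le 1"
    using b by (cases "l = i")
      (auto simp: inner_axis intro: polynomials_le_coordinate polynomials_le_const)
qed

text \<open>Lagrange interpolation with squared distances: \<open>q v\<close> has degree 2 and
  vanishes only at \<open>v\<close>, so at \<open>z\<close> only the summand of \<open>z\<close>
  survives, with a positive factor. Hence the minimum in \<open>threshold_degree\<close> is attained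
  on a finite domain.\<close>

lemma exists_sign_representation:
  fixes Z :: "'a::euclidean_space set"
  assumes "finite Z" "\<And>z. z \<in> Z \<Longrightarrow> h z \<noteq> (0::real)"
  shows "\<exists>d. \<exists>p \<in> polynomials_le (real d). \<forall>z\<in>Z. h z * p z > 0"
proof -
  define q where "q v z = (\<Sum>b\<in>Basis. (z \<bullet> b - v \<bullet> b) * (z \<bullet> b - v \<bullet> b))" for v z :: 'a
  have q: "q v z = (z - v) \<bullet> (z - v)" for v z
    unfolding q_def euclidean_inner[of "z - v" "z - v"] by (simp add: inner_diff_left)
  have "q v \<in> polynomials_le (2 * 1)" for v
    unfolding q_def
    by (intro polynomials_le_sum polynomials_le_mult2 polynomials_le_diff
          polynomials_le_coordinate polynomials_le_const) auto
  then have prod: "(\<lambda>z. \<Prod>v\<in>Z - {w}. q v z) \<in> polynomials_le (\<Sum>v\<in>Z - {w}. 2)" for w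
    by (intro polynomials_le_prod) simp
  have "(\<lambda>z. \<Sum>w\<in>Z. h w * (\<Prod>v\<in>Z - {w}. q v z)) \<in> polynomials_le (real (2 * card Z))"
    by (intro polynomials_le_sum polynomials_le_cmult polynomials_le_mono[OF prod])
       (use assms(1) in \<open>simp add: card_Diff_singleton_if\<close>)
  moreover have "h z * (\<Sum>w\<in>Z. h w * (\<Prod>v\<in>Z - {w}. q v z)) > 0" if z: "z \<in> Z" for z
  proof -
    have "(\<Prod>v\<in>Z - {w}. q v z) = 0" if "w \<in> Z" "w \<noteq> z" for w
      using that z assms(1) by (auto simp: q prod_zero_iff)
    then have "(\<Sum>w\<in>Z. h w * (\<Prod>v\<in>Z - {w}. q v z))
        = (\<Sum>w\<in>Z. if w = z then h z * (\<Prod>v\<in>Z - {z}. q v z) else 0)"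
      by (intro sum.cong) auto
    also have "\<dots> = h z * (\<Prod>v\<in>Z - {z}. q v z)"
      using z assms(1) by simp
    finally have "h z * (\<Sum>w\<in>Z. h w * (\<Prod>v\<in>Z - {w}. q v z)) = (h z * h z) * (\<Prod>v\<in>Z - {z}. q v z)"
      by simp
    moreover have "h z * h z > 0" using assms(2)[OF z] by (simp add: zero_less_mult_iff) linarith
    moreover have "(\<Prod>v\<in>Z - {z}. q v z) > 0"
      by (intro prod_pos) (auto simp: q)
    ultimately show ?thesis by (metis mult_pos_pos)
  qed
  ultimately show ?thesis
    by (intro exI[of _ "2 * card Z"] bexI[of _ "\<lambda>z. \<Sum>w\<in>Z. h w * (\<Prod>v\<in>Z - {w}. q v z)"]) auto
qed

section \<open>A theorem of the alternative\<close>

text \<open>Finite combinations with strictly positive coefficients. The empty combination is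
  excluded, so a member that vanishes on the index set certifies a nontrivial relation.\<close>

inductive_set positive_hull :: "('j \<Rightarrow> real) set \<Rightarrow> ('j \<Rightarrow> real) set" for S where
  base: "v \<in> S \<Longrightarrow> v \<in> positive_hull S"
| comb: "u \<in> positive_hull S \<Longrightarrow> v \<in> positive_hull S \<Longrightarrow> a > 0 \<Longrightarrow> b > 0
    \<Longrightarrow> (\<lambda>j. a * u j + b * v j) \<in> positive_hull S"

lemma positive_hull_subset:
  assumes "S' \<subseteq> positive_hull S"
  shows "positive_hull S' \<subseteq> positive_hull S"
proof
  fix z assume "z \<in> positive_hull S'"
  then show "z \<in> positive_hull S"
    using assms by induction (auto intro: positive_hull.comb)
qed

text \<open>This supplies the value of the eliminated coordinate in the Fourier--Motzkin
  step.\<close>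

lemma exists_between_finite_sets:
  fixes L U :: "real set"
  assumes "finite L" "finite U" "\<And>l u. l \<in> L \<Longrightarrow> u \<in> U \<Longrightarrow> l < u"
  shows "\<exists>t. (\<forall>l\<in>L. l < t) \<and> (\<forall>u\<in>U. t < u)"
proof -
  consider "L = {}" "U = {}" | "L = {}" "U \<noteq> {}" | "L \<noteq> {}" "U = {}" | "L \<noteq> {}" "U \<noteq> {}"
    by blast
  then show ?thesis
  proof cases
    case 2
    have "Min U - 1 < u" if "u \<in> U" for u
      using Min_le[OF assms(2) that] by linarith
    with 2 show ?thesis by (intro exI[of _ "Min U - 1"]) auto
  next
    case 3
    have "l < Max L + 1" if "l \<in> L" for l
      using Max_ge[OF assms(1) that] by linarith
    with 3 show ?thesis by (intro exI[of _ "Max L + 1"]) auto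
  next
    case 4
    then have "Max L < Min U" using assms by simp
    then obtain t where "Max L < t" "t < Min U" using dense by blast
    with 4 assms(1,2) show ?thesis by auto
  qed auto
qed

text \<open>The proof is Fourier--Motzkin elimination of one coordinate at a time.\<close>

lemma gordan_alternative:
  assumes "finite J" "finite S"
  shows "(\<exists>\<theta>. \<forall>v\<in>S. (\<Sum>j\<in>J. \<theta> j * v j) > (0::real)) \<or> (\<exists>z\<in>positive_hull S. \<forall>j\<in>J. z j = 0)"
  using assms
proof (induction J arbitrary: S rule: finite_induct)
  case empty
  show ?case by (cases "S = {}") (auto intro: positive_hull.base)
next
  case (insert k J)
  define pos where "pos = {v\<in>S. v k > 0}"
  define neg where "neg = {v\<in>S. v k < 0}"
  define nul where "nul = {v\<in>S. v k = 0}"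
  \<comment> \<open>For \<open>v k > 0\<close> and \<open>w k < 0\<close> this is a positive
    combination of \<open>v\<close> and \<open>w\<close> whose coordinate \<open>k\<close>
    cancels.\<close>
  define el where "el v w = (\<lambda>j. (- w k) * v j + v k * w j)" for v w :: "'a \<Rightarrow> real"
  define S' where "S' = nul \<union> (\<lambda>(v, w). el v w) ` (pos \<times> neg)"
  have fin: "finite pos" "finite neg" "finite S'"
    using insert.prems by (auto simp: pos_def neg_def nul_def S'_def)
  have "el v w \<in> positive_hull S" if "v \<in> pos" "w \<in> neg" for v w
    unfolding el_def using that
    by (intro positive_hull.comb positive_hull.base) (auto simp: pos_def neg_def)
  then have "S' \<subseteq> positive_hull S"
    by (auto simp: S'_def nul_def intro: positive_hull.base)
  then have hull: "positive_hull S' \<subseteq> positive_hull S" by (rule positive_hull_subset)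
  have zero: "z k = 0" if "z \<in> positive_hull S'" for z
    using that by induction (auto simp: S'_def nul_def el_def)
  consider \<theta> where "\<forall>v\<in>S'. (\<Sum>j\<in>J. \<theta> j * v j) > 0"
    | z where "z \<in> positive_hull S'" "\<forall>j\<in>J. z j = 0"
    using insert.IH[OF fin(3)] by blast
  then show ?case
  proof cases
    case 1
    define L where "L v = (\<Sum>j\<in>J. \<theta> j * v j)" for v
    have el: "(- w k) * L v + v k * L w > 0" if "v \<in> pos" "w \<in> neg" for v w
    proof -
      have "L (el v w) > 0" using 1 that by (auto simp: S'_def L_def)
      moreover have "L (el v w) = (- w k) * L v + v k * L w"
        unfolding L_def el_def sum_distrib_left sum.distrib[symmetric]
        by (intro sum.cong refl) (simp add: algebra_simps)
      ultimately show ?thesis by simp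
    qed
    \<comment> \<open>The vectors in \<open>pos\<close> bound the new coefficient \<open>t\<close>
      from below, those in \<open>neg\<close> from above. The bounds are compatible precisely
      because \<open>\<theta>\<close> is positive on every \<open>el v w\<close>.\<close>
    have "\<exists>t. (\<forall>l\<in>(\<lambda>v. - L v / v k) ` pos. l < t) \<and> (\<forall>u\<in>(\<lambda>w. - L w / w k) ` neg. t < u)"
    proof (rule exists_between_finite_sets)
      fix l u assume "l \<in> (\<lambda>v. - L v / v k) ` pos" "u \<in> (\<lambda>w. - L w / w k) ` neg"
      then obtain v w where vw: "v \<in> pos" "w \<in> neg" "l = - L v / v k" "u = - L w / w k" by auto
      then have "v k > 0" "w k < 0" by (auto simp: pos_def neg_def)
      then show "l < u" using el[OF vw(1,2)] by (simp add: vw(3,4) field_simps)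
    qed (use fin in auto)
    then obtain t where t: "\<And>v. v \<in> pos \<Longrightarrow> - L v / v k < t" "\<And>w. w \<in> neg \<Longrightarrow> t < - L w / w k"
      by blast
    have "t * v k + L v > 0" if "v \<in> S" for v
    proof -
      consider "v \<in> pos" | "v \<in> neg" | "v \<in> nul" 
        using \<open>v \<in> S\<close> by (cases "v k" "0::real" rule: linorder_cases) (auto simp: pos_def neg_def nul_def)
      then show ?thesis
      proof cases
        case 1
        with t(1)[OF 1] show ?thesis by (simp add: pos_def field_simps)
      next
        case 2
        with t(2)[OF 2] show ?thesis by (simp add: neg_def field_simps)
      next
        case 3
        with 1 show ?thesis by (simp add: nul_def S'_def L_def)
      qed
    qed
    moreover have "(\<Sum>j\<in>insert k J. (\<theta>(k := t)) j * v j) = t * v k + L v" for v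
    proof -
      have "(\<Sum>j\<in>J. (\<theta>(k := t)) j * v j) = L v"
        unfolding L_def using insert.hyps by (intro sum.cong) auto
      then show ?thesis using insert.hyps by simp
    qed
    ultimately show ?thesis by (intro disjI1 exI[of _ "\<theta>(k := t)"]) simp
  next
    case 2
    then show ?thesis using hull zero by blast
  qed
qed

text \<open>Gordan's alternative is applied to the rows \<open>c i\<close> together with the unit
  vectors. On the primal side the unit vectors force the weights to be positive; on the dual side
  their coefficients \<open>\<kappa>\<close> become the slack in the inequalities.\<close>

lemma ville_alternative:
  fixes c :: "'i \<Rightarrow> 'j \<Rightarrow> real"
  assumes "finite I" "finite J"
  shows "(\<exists>\<theta>. (\<forall>j\<in>J. \<theta> j > 0) \<and> (\<forall>i\<in>I. (\<Sum>j\<in>J. \<theta> j * c i j) > 0)) \<or>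
    (\<exists>\<mu>. (\<forall>i\<in>I. \<mu> i \<ge> 0) \<and> (\<exists>i\<in>I. \<mu> i > 0) \<and> (\<forall>j\<in>J. (\<Sum>i\<in>I. \<mu> i * c i j) \<le> 0))"
proof -
  define e :: "'j \<Rightarrow> 'j \<Rightarrow> real" where "e j = (\<lambda>k. if k = j then 1 else 0)" for j
  define S where "S = c ` I \<union> e ` J"
  have "finite S" using assms by (simp add: S_def)
  then consider \<theta> where "\<forall>v\<in>S. (\<Sum>j\<in>J. \<theta> j * v j) > 0"
    | z where "z \<in> positive_hull S" "\<forall>j\<in>J. z j = 0"
    using gordan_alternative[OF assms(2)] by blast
  then show ?thesis
  proof cases
    case 1
    have "(\<Sum>j\<in>J. \<theta> j * e k j) = \<theta> k" if "k \<in> J" for k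
      using that assms(2) by (simp add: e_def if_distrib[of "\<lambda>t. _ * t"] cong: if_cong)
    moreover have "e k \<in> S" if "k \<in> J" for k using that by (simp add: S_def)
    ultimately have "\<forall>k\<in>J. \<theta> k > 0" using 1 by metis
    with 1 show ?thesis by (auto simp: S_def)
  next
    case 2
    have "\<exists>\<mu> \<kappa>. (\<forall>i\<in>I. \<mu> i \<ge> 0) \<and> (\<forall>j\<in>J. \<kappa> j \<ge> 0) \<and> ((\<exists>i\<in>I. \<mu> i > 0) \<or> (\<exists>j\<in>J. \<kappa> j > 0))
      \<and> (\<forall>j\<in>J. z j = (\<Sum>i\<in>I. \<mu> i * c i j) + \<kappa> j)"
      using 2(1)
    proof induction
      case (base v)
      then consider i where "i \<in> I" "v = c i" | j where "j \<in> J" "v = e j" by (auto simp: S_def)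
      then show ?case
      proof cases
        case (1 i)
        then show ?thesis using assms
          by (intro exI[of _ "\<lambda>i'. if i' = i then 1 else 0"] exI[of _ "\<lambda>_. 0"])
             (auto simp: if_distrib[of "\<lambda>t. t * _"] cong: if_cong)
      next
        case (2 j)
        then show ?thesis
          by (intro exI[of _ "\<lambda>_. 0"] exI[of _ "e j"]) (auto simp: e_def)
      qed
    next
      case (comb u v a b)
      from comb.IH obtain \<mu> \<kappa> \<mu>' \<kappa>' where
        *: "\<forall>i\<in>I. \<mu> i \<ge> 0" "\<forall>j\<in>J. \<kappa> j \<ge> 0" "(\<exists>i\<in>I. \<mu> i > 0) \<or> (\<exists>j\<in>J. \<kappa> j > 0)"
           "\<forall>j\<in>J. u j = (\<Sum>i\<in>I. \<mu> i * c i j) + \<kappa> j"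
           "\<forall>i\<in>I. \<mu>' i \<ge> 0" "\<forall>j\<in>J. \<kappa>' j \<ge> 0"
           "\<forall>j\<in>J. v j = (\<Sum>i\<in>I. \<mu>' i * c i j) + \<kappa>' j"
        by blast
      have "(\<exists>i\<in>I. a * \<mu> i + b * \<mu>' i > 0) \<or> (\<exists>j\<in>J. a * \<kappa> j + b * \<kappa>' j > 0)"
        using *(3) *(5,6) comb.hyps by (meson add_pos_nonneg less_imp_le mult_nonneg_nonneg mult_pos_pos)
      with * comb.hyps show ?case
        by (intro exI[of _ "\<lambda>i. a * \<mu> i + b * \<mu>' i"] exI[of _ "\<lambda>j. a * \<kappa> j + b * \<kappa>' j"])
           (auto simp: sum_distrib_left sum.distrib algebra_simps)
    qed
    then obtain \<mu> \<kappa> where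
      *: "\<forall>i\<in>I. \<mu> i \<ge> 0" "\<forall>j\<in>J. \<kappa> j \<ge> 0" "(\<exists>i\<in>I. \<mu> i > 0) \<or> (\<exists>j\<in>J. \<kappa> j > 0)"
         "\<forall>j\<in>J. (\<Sum>i\<in>I. \<mu> i * c i j) + \<kappa> j = 0"
      using 2(2) by auto
    \<comment> \<open>If all \<open>\<mu> i\<close> vanished, the equations would make every
      \<open>\<kappa> j\<close> vanish too, and the relation would be trivial.\<close>
    have "\<exists>i\<in>I. \<mu> i > 0"
    proof (rule ccontr)
      assume "\<not> ?thesis"
      with *(1) have "\<mu> i = 0" if "i \<in> I" for i using that by force
      with *(4) have "\<forall>j\<in>J. \<kappa> j = 0" by simp
      with *(3) \<open>\<not> ?thesis\<close> show False by force
    qed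
    moreover have "\<forall>j\<in>J. (\<Sum>i\<in>I. \<mu> i * c i j) \<le> 0"
      using *(2,4) by force
    ultimately show ?thesis using *(1) by blast
  qed
qed


section \<open>Rational approximation\<close>

text \<open>Explicit witnesses replace the infimum, which need not be attained. The passage back
  from the infimum therefore requires a strict inequality.\<close>

definition rationally_approximable ::
    "'a::euclidean_space set \<Rightarrow> ('a \<Rightarrow> real) \<Rightarrow> real \<Rightarrow> real \<Rightarrow> bool" where
  "rationally_approximable X f D e \<longleftrightarrow>
     (\<exists>p\<in>polynomials_le D. \<exists>q\<in>polynomials_le D. \<forall>x\<in>X. q x > 0 \<and> \<bar>f x - p x / q x\<bar> \<le> e)"

lemma rationally_approximableI:
  assumes "p \<in> polynomials_le D" "q \<in> polynomials_le D"
    and "\<And>x. x \<in> X \<Longrightarrow> q x > 0" "\<And>x. x \<in> X \<Longrightarrow> \<bar>f x - p x / q x\<bar> \<le> e"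
  shows "rationally_approximable X f D e"
  using assms unfolding rationally_approximable_def by blast

lemma rationally_approximable_mono:
  "rationally_approximable X f D e \<Longrightarrow> D \<le> D' \<Longrightarrow> e \<le> e' \<Longrightarrow> rationally_approximable X f D' e'"
  unfolding rationally_approximable_def by (meson order_trans polynomials_le_mono)

lemma rational_approx_error_le:
  assumes "finite X" "X \<noteq> {}" "rationally_approximable X f D e"
  shows "rational_approx_error X f D \<le> e"
proof -
  obtain p q where pq: "p \<in> polynomials_le D" "q \<in> polynomials_le D"
    "\<And>x. x \<in> X \<Longrightarrow> q x > 0" "\<And>x. x \<in> X \<Longrightarrow> \<bar>f x - p x / q x\<bar> \<le> e"
    using assms(3) unfolding rationally_approximable_def by blast
  let ?S = "{SUP x\<in>X. \<bar>f x - p x / q x\<bar> | p q.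
            p \<in> polynomials_le D \<and> q \<in> polynomials_le D \<and> (\<forall>x\<in>X. q x > 0)}"
  obtain x0 where x0: "x0 \<in> X" using assms(2) by blast
  have "0 \<le> (SUP x\<in>X. \<bar>f x - p x / q x\<bar>)" for p q
    by (rule cSUP_upper2[OF _ x0]) (use assms(1) in auto)
  then have "bdd_below ?S" by (auto intro!: bdd_belowI[of _ 0])
  then have "rational_approx_error X f D \<le> (SUP x\<in>X. \<bar>f x - p x / q x\<bar>)"
    unfolding rational_approx_error_def using pq by (intro cInf_lower) auto
  also have "\<dots> \<le> e" using assms(2) pq(4) by (rule cSUP_least)
  finally show ?thesis .
qed

lemma rationally_approximable_if_error_less:
  assumes "finite X" "0 \<le> D" "rational_approx_error X f D < e"
  shows "rationally_approximable X f D e"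
proof -
  let ?S = "{SUP x\<in>X. \<bar>f x - p x / q x\<bar> | p q.
            p \<in> polynomials_le D \<and> q \<in> polynomials_le D \<and> (\<forall>x\<in>X. q x > 0)}"
  have "?S \<noteq> {}"
    using polynomials_le_const[OF assms(2), of 1] by fastforce
  then obtain p q where pq: "p \<in> polynomials_le D" "q \<in> polynomials_le D" "\<forall>x\<in>X. q x > 0"
    "(SUP x\<in>X. \<bar>f x - p x / q x\<bar>) < e"
    using cInf_lessD[of ?S e] assms(3) unfolding rational_approx_error_def by blast
  have "\<bar>f x - p x / q x\<bar> \<le> e" if "x \<in> X" for x
  proof -
    have "\<bar>f x - p x / q x\<bar> \<le> (SUP x\<in>X. \<bar>f x - p x / q x\<bar>)"
      using that assms(1) by (intro cSUP_upper) auto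
    with pq(4) show ?thesis by linarith
  qed
  with pq show ?thesis by (intro rationally_approximableI[of p _ q]) auto
qed

text \<open>Divided by its largest modulus \<open>M\<close>, the polynomial has the sign of
  \<open>f\<close> and modulus between \<open>m / M\<close> and 1 on \<open>X\<close>; the
  denominator is 1.\<close>

lemma rationally_approximable_if_sign_rep:
  assumes "finite X" "X \<noteq> {}" "0 \<le> D" "p \<in> polynomials_le D"
    and "\<And>x. x \<in> X \<Longrightarrow> f x = -1 \<or> f x = 1" "\<And>x. x \<in> X \<Longrightarrow> f x * p x > 0"
  shows "\<exists>e<1. rationally_approximable X f D e"
proof -
  define m M where "m = Min ((\<lambda>x. \<bar>p x\<bar>) ` X)" and "M = Max ((\<lambda>x. \<bar>p x\<bar>) ` X)"
  have m: "m \<le> \<bar>p x\<bar>" and M: "\<bar>p x\<bar> \<le> M" if "x \<in> X" for x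
    using that assms(1) by (auto simp: m_def M_def)
  have "\<bar>p x\<bar> > 0" if "x \<in> X" for x using assms(6)[OF that] by auto
  then have "m > 0" using assms(1,2) by (simp add: m_def)
  moreover have "m \<le> M" using m M assms(2) by force
  ultimately have "M > 0" by simp
  have "\<bar>f x - (1 / M * p x) / 1\<bar> \<le> 1 - m / M" if x: "x \<in> X" for x
  proof -
    define r where "r = p x / M"
    have "m / M \<le> \<bar>r\<bar>" "\<bar>r\<bar> \<le> 1"
      using m[OF x] M[OF x] \<open>M > 0\<close> by (auto simp: r_def abs_divide divide_right_mono)
    moreover have "f x * r > 0" using assms(6)[OF x] \<open>M > 0\<close> by (simp add: r_def)
    ultimately have "\<bar>f x - r\<bar> \<le> 1 - m / M" using assms(5)[OF x] by auto
    then show ?thesis by (simp add: r_def)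
  qed
  then have "rationally_approximable X f D (1 - m / M)"
    by (intro rationally_approximableI[OF polynomials_le_cmult[OF assms(4), of "1 / M"]
          polynomials_le_const[OF assms(3), of 1]]) auto
  moreover have "1 - m / M < 1" using \<open>m > 0\<close> \<open>M > 0\<close> by simp
  ultimately show ?thesis by blast
qed

text \<open>The map \<open>r \<mapsto> 2 r / (1 + r\<^sup>2)\<close> fixes \<open>\<plusminus>1\<close> to second order.\<close>

lemma rationally_approximable_square:
  assumes "rationally_approximable X f D e" "\<And>x. x \<in> X \<Longrightarrow> f x = -1 \<or> f x = 1"
  shows "rationally_approximable X f (2 * D) (e\<^sup>2)"
proof -
  obtain p q where pq: "p \<in> polynomials_le D" "q \<in> polynomials_le D"
    "\<And>x. x \<in> X \<Longrightarrow> q x > 0" "\<And>x. x \<in> X \<Longrightarrow> \<bar>f x - p x / q x\<bar> \<le> e"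
    using assms(1) unfolding rationally_approximable_def by blast
  have *: "0 < p x * p x + q x * q x \<and>
      \<bar>f x - (2 * (p x * q x)) / (p x * p x + q x * q x)\<bar> \<le> e\<^sup>2" if x: "x \<in> X" for x
  proof -
    define r where "r = p x / q x"
    have p: "p x = r * q x" using pq(3)[OF x] by (simp add: r_def)
    have q2: "q x * q x > 0" using pq(3)[OF x] by simp
    have r1: "1 + r\<^sup>2 \<ge> 1" "1 + r\<^sup>2 > 0" by (simp_all add: add_pos_nonneg)
    have "p x * p x + q x * q x = (1 + r\<^sup>2) * (q x * q x)" "2 * (p x * q x) = 2 * r * (q x * q x)"
      by (simp_all add: p power2_eq_square algebra_simps)
    then have "(2 * (p x * q x)) / (p x * p x + q x * q x) = 2 * r / (1 + r\<^sup>2)"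
      using pq(3)[OF x] by simp
    \<comment> \<open>By \<open>(f x)\<^sup>2 = 1\<close> the difference is a perfect square over a
      denominator that is at least 1, which squares the error.\<close>
    moreover have "f x - 2 * r / (1 + r\<^sup>2) = f x * ((f x - r)\<^sup>2 / (1 + r\<^sup>2))"
      using assms(2)[OF x] r1 by (auto simp: field_simps power2_eq_square add_nonneg_eq_0_iff)
    ultimately have "\<bar>f x - (2 * (p x * q x)) / (p x * p x + q x * q x)\<bar> = (f x - r)\<^sup>2 / (1 + r\<^sup>2)"
      using assms(2)[OF x] by (auto simp: abs_mult)
    also have "\<dots> \<le> (f x - r)\<^sup>2 / 1" using r1 by (intro divide_left_mono) (auto simp: mult_pos_pos)
    also have "\<dots> \<le> e\<^sup>2" using pq(4)[OF x] by (simp add: r_def abs_le_square_iff[symmetric])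
    finally show ?thesis using q2 by (simp add: add_nonneg_pos)
  qed
  show ?thesis
    by (rule rationally_approximableI[OF
          polynomials_le_cmult[OF polynomials_le_mult2[OF pq(1,2)], of 2]
          polynomials_le_add[OF polynomials_le_mult2[OF pq(1,1)] polynomials_le_mult2[OF pq(2,2)]]])
       (use * in auto)
qed

lemma rationally_approximable_power:
  assumes "rationally_approximable X f D e" "\<And>x. x \<in> X \<Longrightarrow> f x = -1 \<or> f x = 1"
  shows "rationally_approximable X f (2 ^ n * D) (e ^ (2 ^ n))"
proof (induction n)
  case (Suc n)
  have "(e ^ 2 ^ n)\<^sup>2 = e ^ 2 ^ Suc n" by (simp add: power_mult[symmetric] mult.commute)
  with rationally_approximable_square[OF Suc assms(2)] show ?case by (simp add: mult.assoc)
qed (use assms in simp)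

text \<open>If the smaller of \<open>u\<close>, \<open>v\<close> is \<open>t\<close> times the other
  with \<open>t \<le> e\<close>, then \<open>(v - u) / (u + v)\<close> has modulus
  \<open>(1 - t) / (1 + t)\<close> up to sign. The factor \<open>1 + e\<close> moves the possible
  values into the interval from \<open>1 - e\<close> to \<open>1 + e\<close>.\<close>

lemma rationally_approximable_if_ratio:
  assumes "u \<in> polynomials_le D" "v \<in> polynomials_le D"
    and "\<And>x. x \<in> X \<Longrightarrow> f x = -1 \<or> f x = 1" "0 \<le> e"
    and "\<And>x. x \<in> X \<Longrightarrow> u x \<ge> 0" "\<And>x. x \<in> X \<Longrightarrow> v x \<ge> 0" "\<And>x. x \<in> X \<Longrightarrow> u x + v x > 0"
    and "\<And>x. x \<in> X \<Longrightarrow> f x = -1 \<Longrightarrow> v x \<le> e * u x"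
    and "\<And>x. x \<in> X \<Longrightarrow> f x = 1 \<Longrightarrow> u x \<le> e * v x"
  shows "rationally_approximable X f D e"
proof -
  have "\<bar>f x - ((1 + e) * (v x - u x)) / (u x + v x)\<bar> \<le> e" if x: "x \<in> X" for x
  proof -
    have nn: "u x \<ge> 0" "v x \<ge> 0" "e * u x \<ge> 0" "e * v x \<ge> 0"
      using assms(4) assms(5,6)[OF x] by auto
    have pos: "u x + v x > 0" using assms(7)[OF x] .
    then have "f x - ((1 + e) * (v x - u x)) / (u x + v x)
        = (f x * (u x + v x) - (1 + e) * (v x - u x)) / (u x + v x)"
      by (simp add: field_simps)
    moreover have "\<bar>f x * (u x + v x) - (1 + e) * (v x - u x)\<bar> \<le> e * (u x + v x)"
      using assms(3)[OF x]
    proof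
      assume "f x = -1"
      with nn assms(8)[OF x] show ?thesis by (auto simp: abs_le_iff algebra_simps)
    next
      assume "f x = 1"
      with nn assms(9)[OF x] show ?thesis by (auto simp: abs_le_iff algebra_simps)
    qed
    ultimately show ?thesis using pos by (simp add: abs_divide pos_divide_le_eq)
  qed
  with assms(7) show ?thesis
    by (intro rationally_approximableI[OF
          polynomials_le_cmult[OF polynomials_le_diff[OF assms(2,1)], of "1 + e"]
          polynomials_le_add[OF assms(1,2)]])
qed

section \<open>Conjunctions of two functions\<close>

text \<open>\<open>P\<close> is minus a sign representation of the conjunction, since true is
  encoded as -1. The degree is bounded in each argument separately, so no polynomials on a product
  space are involved.\<close>

locale conjunction_sign_rep =
  fixes d :: real and X :: "'a::euclidean_space set" and Y :: "'b::euclidean_space set"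
    and f :: "'a \<Rightarrow> real" and g :: "'b \<Rightarrow> real" and P :: "'a \<Rightarrow> 'b \<Rightarrow> real"
  assumes d_nonneg: "0 \<le> d"
    and finite_X: "finite X" and finite_Y: "finite Y"
    and f_values: "x \<in> X \<Longrightarrow> f x = -1 \<or> f x = 1"
    and g_values: "y \<in> Y \<Longrightarrow> g y = -1 \<or> g y = 1"
    and poly_X: "y \<in> Y \<Longrightarrow> (\<lambda>x. P x y) \<in> polynomials_le d"
    and poly_Y: "x \<in> X \<Longrightarrow> (\<lambda>y. P x y) \<in> polynomials_le d"
    and P_pos: "x \<in> X \<Longrightarrow> y \<in> Y \<Longrightarrow> f x = -1 \<Longrightarrow> g y = -1 \<Longrightarrow> P x y > 0"
    and P_neg: "x \<in> X \<Longrightarrow> y \<in> Y \<Longrightarrow> f x = 1 \<or> g y = 1 \<Longrightarrow> P x y < 0"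
begin

lemma swap: "conjunction_sign_rep d Y X g f (\<lambda>y x. P x y)"
  by unfold_locales
    (use d_nonneg finite_X finite_Y f_values g_values poly_X poly_Y P_pos P_neg in auto)

lemma sum_Y_split: "(\<Sum>y\<in>Y. h y) = (\<Sum>y | y \<in> Y \<and> g y = -1. h y) + (\<Sum>y | y \<in> Y \<and> g y = 1. h y)"
  for h :: "'b \<Rightarrow> real"
  using finite_Y g_values by (subst sum.union_disjoint[symmetric]) (auto intro!: sum.cong)

lemma sum_X_split: "(\<Sum>x\<in>X. h x) = (\<Sum>x | x \<in> X \<and> f x = -1. h x) + (\<Sum>x | x \<in> X \<and> f x = 1. h x)"
  for h :: "'a \<Rightarrow> real"
  using finite_X f_values by (subst sum.union_disjoint[symmetric]) (auto intro!: sum.cong)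

text \<open>For fixed \<open>x\<close> in \<open>X\<close> the sign of \<open>P x y\<close> is
  constant on the true points of \<open>g\<close>, and likewise on the false points. With positive
  weights, \<open>num\<close> and \<open>den\<close> are thus moduli of weighted sums of
  \<open>P x y\<close>, that is, polynomials in \<open>x\<close> up to sign.\<close>

definition num :: "('b \<Rightarrow> real) \<Rightarrow> 'a \<Rightarrow> real" where
  "num \<theta> x = (\<Sum>y | y \<in> Y \<and> g y = -1. \<theta> y * \<bar>P x y\<bar>)"

definition den :: "('b \<Rightarrow> real) \<Rightarrow> 'a \<Rightarrow> real" where
  "den \<theta> x = (\<Sum>y | y \<in> Y \<and> g y = 1. \<theta> y * \<bar>P x y\<bar>)"

text \<open>Both inequalities are strict, to match the strict system in
  \<open>ville_alternative\<close>.\<close>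

definition balanced :: "real \<Rightarrow> bool" where
  "balanced s \<longleftrightarrow> (\<exists>\<theta>. (\<forall>y\<in>Y. \<theta> y > 0) \<and>
     (\<forall>x\<in>X. num \<theta> x < s * den \<theta> x \<and> den \<theta> x < s * num \<theta> x))"

text \<open>The approximant equals \<open>f x\<close> times
  \<open>2 a b / (a\<^sup>2 + b\<^sup>2)\<close> with \<open>a = num \<theta> x\<close> and
  \<open>b = den \<theta> x\<close>. This factor is at most 1, and it is at least its value for the
  extreme ratio \<open>s\<close> of \<open>a\<close> and \<open>b\<close>.\<close>

lemma approximable_if_balanced:
  assumes "balanced s" "s > 0"
  shows "rationally_approximable X f (2 * d) (1 - 2 * s / (1 + s\<^sup>2))"
proof -
  obtain \<theta> where \<theta>: "\<And>y. y \<in> Y \<Longrightarrow> \<theta> y > 0"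
    and bal: "\<And>x. x \<in> X \<Longrightarrow> num \<theta> x < s * den \<theta> x" "\<And>x. x \<in> X \<Longrightarrow> den \<theta> x < s * num \<theta> x"
    using assms(1) unfolding balanced_def by blast
  define N where "N x = (\<Sum>y | y \<in> Y \<and> g y = -1. \<theta> y * P x y)" for x
  define M where "M x = - (\<Sum>y | y \<in> Y \<and> g y = 1. \<theta> y * P x y)" for x
  have poly: "N \<in> polynomials_le d" "M \<in> polynomials_le d"
    unfolding N_def[abs_def] M_def[abs_def]
    by (intro polynomials_le_sum polynomials_le_cmult polynomials_le_uminus poly_X; simp)+
  have N: "N x = - f x * num \<theta> x" if x: "x \<in> X" for x
    using f_values[OF x]
  proof
    assume f: "f x = -1"
    have "N x = num \<theta> x"
      unfolding N_def num_def using P_pos[OF x _ f]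
      by (intro sum.cong refl) (auto intro!: abs_of_pos[symmetric])
    then show ?thesis using f by simp
  next
    assume f: "f x = 1"
    then have "\<bar>P x y\<bar> = - P x y" if "y \<in> Y" for y using P_neg[OF x that] by simp
    then show ?thesis using f by (simp add: N_def num_def sum_negf)
  qed
  have M: "M x = den \<theta> x" if x: "x \<in> X" for x
  proof -
    have "\<bar>P x y\<bar> = - P x y" if "y \<in> Y" "g y = 1" for y using P_neg[OF x that(1)] that by simp
    then show ?thesis by (simp add: M_def den_def sum_negf)
  qed
  have *: "0 < N x * N x + M x * M x \<and>
      \<bar>f x - (- 2 * (N x * M x)) / (N x * N x + M x * M x)\<bar> \<le> 1 - 2 * s / (1 + s\<^sup>2)"
    if x: "x \<in> X" for x
  proof -
    define a b where "a = num \<theta> x" and "b = den \<theta> x"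
    have "a \<ge> 0" "b \<ge> 0" unfolding a_def b_def num_def den_def
      using \<theta> by (auto intro!: sum_nonneg mult_nonneg_nonneg simp: less_imp_le)
    moreover have ab: "a < s * b" "b < s * a" using bal[OF x] by (auto simp: a_def b_def)
    ultimately have pos: "a > 0" "b > 0"
      using assms(2) by (metis less_eq_real_def linorder_not_less mult_zero_right)+
    then have den_pos: "a * a + b * b > 0" by (simp add: add_pos_pos)
    have s2: "1 + s\<^sup>2 > 0" by (simp add: add_pos_nonneg)
    \<comment> \<open>Expanded, the product is
      \<open>a * b * (1 + s\<^sup>2) - s * (a\<^sup>2 + b\<^sup>2)\<close>, the comparison of the
      two fractions with denominators cleared.\<close>
    have "(s * a - b) * (s * b - a) \<ge> 0" using ab by simp
    then have "2 * s * (a * a + b * b) \<le> 2 * (a * b) * (1 + s\<^sup>2)"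
      by (simp add: algebra_simps power2_eq_square)
    then have le: "2 * s / (1 + s\<^sup>2) \<le> 2 * (a * b) / (a * a + b * b)"
      using den_pos s2 by (simp add: divide_simps)
    have "2 * (a * b) \<le> a * a + b * b"
      using zero_le_square[of "a - b"] by (simp add: algebra_simps)
    then have "2 * (a * b) / (a * a + b * b) \<le> 1" using den_pos by (simp add: divide_le_eq)
    moreover have sq: "N x * N x + M x * M x = a * a + b * b"
      using f_values[OF x] by (auto simp: N[OF x] M[OF x] a_def b_def)
    moreover have "(- 2 * (N x * M x)) / (a * a + b * b) = f x * (2 * (a * b) / (a * a + b * b))"
      by (simp add: N[OF x] M[OF x] a_def b_def)
    ultimately have "\<bar>f x - (- 2 * (N x * M x)) / (N x * N x + M x * M x)\<bar>
        = 1 - 2 * (a * b) / (a * a + b * b)"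
      using f_values[OF x] by (auto simp only:)
    with le den_pos sq show ?thesis by simp
  qed
  show ?thesis
    by (rule rationally_approximableI[OF
          polynomials_le_cmult[OF polynomials_le_mult2[OF poly], of "-2"]
          polynomials_le_add[OF polynomials_le_mult2[OF poly(1,1)] polynomials_le_mult2[OF poly(2,2)]]])
       (use * in auto)
qed

text \<open>For fixed \<open>y\<close> the sign of \<open>P x y\<close> depends only on
  \<open>f x\<close>, so absolute values can be pulled out of the sum over each value class of
  \<open>f\<close>. On the true points of \<open>f\<close> that sign is
  \<open>- g y\<close>.\<close>

lemma weighted_abs_sum:
  assumes "y \<in> Y" "\<And>x. x \<in> X \<Longrightarrow> \<mu> x \<ge> 0"
  shows "(\<Sum>x\<in>X. \<mu> x * \<bar>P x y\<bar>)
    = \<bar>\<Sum>x | x \<in> X \<and> f x = -1. \<mu> x * P x y\<bar> + \<bar>\<Sum>x | x \<in> X \<and> f x = 1. \<mu> x * P x y\<bar>"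
proof -
  have "(\<Sum>x | x \<in> X \<and> f x = 1. \<mu> x * \<bar>P x y\<bar>) = \<bar>\<Sum>x | x \<in> X \<and> f x = 1. \<mu> x * P x y\<bar>"
  proof -
    have P: "\<bar>P x y\<bar> = - P x y" if "x \<in> X" "f x = 1" for x using P_neg[OF that(1) assms(1)] that by simp
    have "(\<Sum>x | x \<in> X \<and> f x = 1. \<mu> x * \<bar>P x y\<bar>) = - (\<Sum>x | x \<in> X \<and> f x = 1. \<mu> x * P x y)"
      by (simp add: P sum_negf)
    moreover have "(\<Sum>x | x \<in> X \<and> f x = 1. \<mu> x * \<bar>P x y\<bar>) \<ge> 0"
      using assms(2) by (auto intro!: sum_nonneg)
    ultimately show ?thesis by linarith
  qed
  moreover have "(\<Sum>x | x \<in> X \<and> f x = -1. \<mu> x * \<bar>P x y\<bar>) = \<bar>\<Sum>x | x \<in> X \<and> f x = -1. \<mu> x * P x y\<bar>"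
  proof -
    define \<sigma> where "\<sigma> = - g y"
    have \<sigma>: "\<sigma> = 1 \<or> \<sigma> = -1" using g_values[OF assms(1)] by (auto simp: \<sigma>_def)
    have P: "\<bar>P x y\<bar> = \<sigma> * P x y" if "x \<in> X" "f x = -1" for x
      using g_values[OF assms(1)] P_neg[OF that(1) assms(1)] P_pos[OF that(1) assms(1) that(2)]
      by (auto simp: \<sigma>_def)
    have "(\<Sum>x | x \<in> X \<and> f x = -1. \<mu> x * \<bar>P x y\<bar>) = \<sigma> * (\<Sum>x | x \<in> X \<and> f x = -1. \<mu> x * P x y)"
      by (simp add: P sum_distrib_left mult.left_commute)
    moreover have "(\<Sum>x | x \<in> X \<and> f x = -1. \<mu> x * \<bar>P x y\<bar>) \<ge> 0"
      using assms(2) by (auto intro!: sum_nonneg)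
    ultimately show ?thesis using \<sigma> by auto
  qed
  ultimately show ?thesis using sum_X_split[of "\<lambda>x. \<mu> x * \<bar>P x y\<bar>"] by simp
qed

text \<open>Dual weights give two sums \<open>S True\<close> and \<open>S False\<close> of which the
  first dominates by a factor \<open>s\<close> at true points of \<open>g\<close>, the second at
  false points. Passing to polynomials squares this factor and costs a factor 2.\<close>

lemma approximable_if_not_balanced:
  assumes "\<not> balanced s" "s > 0"
  shows "rationally_approximable Y g (2 * d) (2 / s\<^sup>2)"
proof -
  \<comment> \<open>The Boolean tag selects one of the two inequalities of \<open>balanced\<close>
    at \<open>x\<close>: \<open>True\<close> for \<open>num < s * den\<close>, \<open>False\<close>
    for \<open>den < s * num\<close>.\<close>
  define c where "c = (\<lambda>(x, b) y. (if g y = -1 then (if b then -1 else s) else (if b then s else -1)) * \<bar>P x y\<bar>)"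
  have row: "(\<Sum>y\<in>Y. \<theta> y * c (x, True) y) = s * den \<theta> x - num \<theta> x"
    "(\<Sum>y\<in>Y. \<theta> y * c (x, False) y) = s * num \<theta> x - den \<theta> x" for \<theta> x
    unfolding sum_Y_split
    by (simp_all add: c_def num_def den_def sum_distrib_left sum_negf mult.left_commute)
  have "\<not> (\<exists>\<theta>. (\<forall>y\<in>Y. \<theta> y > 0) \<and> (\<forall>i\<in>X \<times> UNIV. (\<Sum>y\<in>Y. \<theta> y * c i y) > 0))"
  proof
    assume "\<exists>\<theta>. (\<forall>y\<in>Y. \<theta> y > 0) \<and> (\<forall>i\<in>X \<times> UNIV. (\<Sum>y\<in>Y. \<theta> y * c i y) > 0)"
    then obtain \<theta> where \<theta>: "\<forall>y\<in>Y. \<theta> y > 0" "\<And>x b. x \<in> X \<Longrightarrow> (\<Sum>y\<in>Y. \<theta> y * c (x, b) y) > 0"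
      by blast
    have "num \<theta> x < s * den \<theta> x \<and> den \<theta> x < s * num \<theta> x" if "x \<in> X" for x
      using \<theta>(2)[OF that, of True] \<theta>(2)[OF that, of False] by (simp add: row)
    with \<theta>(1) assms(1) show False unfolding balanced_def by blast
  qed
  then obtain \<mu> where \<mu>: "\<forall>i\<in>X \<times> UNIV. \<mu> i \<ge> 0" "\<exists>i\<in>X \<times> UNIV. \<mu> i > 0"
      "\<forall>y\<in>Y. (\<Sum>i\<in>X \<times> UNIV. \<mu> i * c i y) \<le> 0"
    using ville_alternative[of "X \<times> UNIV" Y c] finite_X finite_Y by auto
  define S where "S b y = (\<Sum>x\<in>X. \<mu> (x, b) * \<bar>P x y\<bar>)" for b y
  define w where "w b t y = (\<Sum>x | x \<in> X \<and> f x = t. \<mu> (x, b) * P x y)" for b t y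
  txt \<open>
    The dual sums \<open>S b\<close> involve absolute values; splitting them by the value of \<open>f\<close> gives two summands
    that are polynomials up to sign, so a sum of squares recovers \<open>(S b)\<^sup>2\<close> up to a factor \<open>2\<close>.
  \<close>
  define u where "u b y = w b (-1) y * w b (-1) y + w b 1 y * w b 1 y" for b y
  have poly: "u b \<in> polynomials_le (2 * d)" for b
    unfolding u_def[abs_def] w_def
    by (intro polynomials_le_add polynomials_le_mult2 polynomials_le_sum polynomials_le_cmult; simp add: poly_Y)
  have S: "S b y = \<bar>w b (-1) y\<bar> + \<bar>w b 1 y\<bar>" if "y \<in> Y" for b y
    unfolding S_def w_def using that \<mu>(1) by (intro weighted_abs_sum) auto
  have u: "u b y \<le> (S b y)\<^sup>2" "(S b y)\<^sup>2 \<le> 2 * u b y" "u b y \<ge> 0" if "y \<in> Y" for b y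
  proof -
    define p q where "p = \<bar>w b (-1) y\<bar>" and "q = \<bar>w b 1 y\<bar>"
    have "p \<ge> 0" "q \<ge> 0" "u b y = p * p + q * q" "S b y = p + q"
      using that by (auto simp: p_def q_def u_def S)
    moreover have "(p - q) * (p - q) \<ge> 0" by simp
    ultimately show "u b y \<le> (S b y)\<^sup>2" "(S b y)\<^sup>2 \<le> 2 * u b y" "u b y \<ge> 0"
      by (auto simp: power2_eq_square algebra_simps)
  qed
  have col: "(\<Sum>i\<in>X \<times> UNIV. \<mu> i * c i y)
      = (if g y = -1 then s * S False y - S True y else s * S True y - S False y)" for y
  proof -
    have "(\<Sum>i\<in>X \<times> UNIV. \<mu> i * c i y) = (\<Sum>x\<in>X. \<mu> (x, False) * c (x, False) y + \<mu> (x, True) * c (x, True) y)"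
      unfolding sum.cartesian_product' by (simp add: UNIV_bool)
    then show ?thesis
      by (simp add: c_def S_def sum.distrib sum_distrib_left sum_negf mult.left_commute)
  qed
  have S_nonneg: "S b y \<ge> 0" for b y
    unfolding S_def using \<mu>(1) by (auto intro!: sum_nonneg)
  \<comment> \<open>One positive dual weight suffices, because \<open>P\<close> vanishes nowhere on
    the product of \<open>X\<close> and \<open>Y\<close>. This keeps the denominator of the
    approximant positive.\<close>
  have S_pos: "\<exists>b. S b y > 0" if y: "y \<in> Y" for y
  proof -
    obtain x b where x: "x \<in> X" "\<mu> (x, b) > 0" using \<mu>(2) by auto
    have "P x y \<noteq> 0"
      using P_pos[OF x(1) y] P_neg[OF x(1) y] f_values[OF x(1)] g_values[OF y] by force
    then have "0 < \<mu> (x, b) * \<bar>P x y\<bar>" using x by simp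
    also have "\<dots> \<le> S b y"
      unfolding S_def using x(1) finite_X \<mu>(1) by (intro member_le_sum) auto
    finally show ?thesis by blast
  qed
  show ?thesis
  proof (rule rationally_approximable_if_ratio[of "u True" _ "u False"])
    fix y assume y: "y \<in> Y"
    obtain b where "S b y > 0" using S_pos[OF y] by blast
    then have "u b y > 0" using u(2)[OF y, of b] by (smt (verit) zero_less_power)
    then show "u True y + u False y > 0"
      using u(3)[OF y, of True] u(3)[OF y, of False] by (cases b) auto
    have bound: "u b y \<le> 2 / s\<^sup>2 * u b' y" if "s * S b y \<le> S b' y" for b b'
    proof -
      have "(s * S b y)\<^sup>2 \<le> (S b' y)\<^sup>2"
        using that assms(2) S_nonneg by (intro power_mono) auto
      then have "s\<^sup>2 * u b y \<le> 2 * u b' y"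
        using u(1)[OF y, of b] u(2)[OF y, of b'] mult_left_mono[of "u b y" "(S b y)\<^sup>2" "s\<^sup>2"]
        by (simp add: power_mult_distrib)
      then show ?thesis using assms(2) by (simp add: field_simps)
    qed
    show "u False y \<le> 2 / s\<^sup>2 * u True y" if "g y = -1"
      using \<mu>(3) y that by (intro bound) (auto simp: col)
    show "u True y \<le> 2 / s\<^sup>2 * u False y" if "g y = 1"
      using \<mu>(3) y that by (intro bound) (auto simp: col)
  qed (use poly g_values u in auto)
qed

text \<open>With unit weights both sums are positive, as \<open>g\<close> takes both values, and on
  a finite set their ratios are bounded; \<open>K\<close> dominates all of them.\<close>

lemma exists_balanced:
  assumes "\<exists>y\<in>Y. g y = -1" "\<exists>y\<in>Y. g y = 1"
  shows "\<exists>n. balanced ((3 / 2) ^ n)"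
proof -
  define a b where "a = num (\<lambda>_. 1)" and "b = den (\<lambda>_. 1)"
  have "P x y \<noteq> 0" if "x \<in> X" "y \<in> Y" for x y
    using P_pos[OF that] P_neg[OF that] f_values[OF that(1)] g_values[OF that(2)] by force
  then have pos: "a x > 0" "b x > 0" if "x \<in> X" for x
    unfolding a_def b_def num_def den_def using assms finite_Y that by (auto intro!: sum_pos)
  define K where "K = (\<Sum>x\<in>X. a x / b x + b x / a x)"
  obtain n where n: "K < (3 / 2) ^ n" using real_arch_pow[of "3 / 2" K] by auto
  have "a x < (3 / 2) ^ n * b x \<and> b x < (3 / 2) ^ n * a x" if x: "x \<in> X" for x
  proof -
    have "a x / b x + b x / a x \<le> K"
      unfolding K_def using x finite_X pos by (intro member_le_sum) (auto simp: less_imp_le)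
    moreover have "a x / b x > 0" "b x / a x > 0" using pos[OF x] by auto
    ultimately have "a x / b x < (3 / 2) ^ n" "b x / a x < (3 / 2) ^ n" using n by linarith+
    then show ?thesis using pos[OF x] by (simp add: divide_less_eq)
  qed
  then show ?thesis unfolding balanced_def a_def b_def
    by (intro exI[of _ n] exI[of _ "\<lambda>_. 1"]) auto
qed

text \<open>The critical \<open>s\<close> is located up to a factor 3/2: \<open>s\<close> is the
  first balanced power, so the preceding power \<open>r = 2 s / 3\<close> is not balanced and yields
  the error \<open>9 / (2 s\<^sup>2)\<close> for \<open>g\<close>.\<close>

lemma half_or_complementary_errors:
  assumes "\<exists>y\<in>Y. g y = -1" "\<exists>y\<in>Y. g y = 1"
  shows "(\<exists>e<1/2. rationally_approximable X f (2 * d) e) \<or>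
    (\<exists>e e'. e + e' < 1 \<and> rationally_approximable X f (2 * d) e \<and> rationally_approximable Y g (2 * d) e')"
proof -
  define n where "n = (LEAST n. balanced ((3 / 2) ^ n))"
  define s :: real where "s = (3 / 2) ^ n"
  have "balanced s"
    unfolding s_def n_def using exists_balanced[OF assms] by (rule LeastI_ex)
  moreover have "s > 0" by (simp add: s_def)
  ultimately have f: "rationally_approximable X f (2 * d) (1 - 2 * s / (1 + s\<^sup>2))"
    by (rule approximable_if_balanced)
  have s2: "1 + s\<^sup>2 > 0" by (simp add: add_pos_nonneg)
  show ?thesis
  \<comment> \<open>Up to \<open>s = 9/4\<close> the error for \<open>f\<close> is below 1/2; from
    \<open>s = 27/8\<close> on the two errors add up to less than 1.\<close>
  proof (cases "n \<le> 2")
    case True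
    then have "n = 0 \<or> n = 1 \<or> n = 2" by auto
    then have "1 - 2 * s / (1 + s\<^sup>2) < 1 / 2" by (auto simp: s_def power2_eq_square)
    with f show ?thesis by blast
  next
    case False
    then obtain m where m: "n = Suc m" "m \<ge> 2" by (cases n) auto
    define r :: real where "r = (3 / 2) ^ m"
    have "\<not> balanced r"
      unfolding r_def by (rule not_less_Least) (use m in \<open>simp add: n_def\<close>)
    moreover have "r > 0" by (simp add: r_def)
    ultimately have g: "rationally_approximable Y g (2 * d) (2 / r\<^sup>2)"
      by (rule approximable_if_not_balanced)
    have r: "r = 2 / 3 * s" by (simp add: r_def s_def m)
    have "(3 / 2) ^ 3 \<le> s" unfolding s_def using m by (intro power_increasing) auto
    then have "s \<ge> 27 / 8" by (simp add: power3_eq_cube)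
    \<comment> \<open>The required inequality is \<open>9 < s\<^sup>2 * (4 * s - 9)\<close>; both
      factors on the right are increasing, and \<open>4 * (27/8) - 9 = 9/2\<close>.\<close>
    then have "(27 / 8)\<^sup>2 * (9 / 2) \<le> s\<^sup>2 * (4 * s - 9)"
      by (intro mult_mono power_mono) auto
    then have "9 * (1 + s\<^sup>2) < 4 * s * s\<^sup>2" by (simp add: algebra_simps power_divide)
    then have "9 / (2 * s\<^sup>2) < 2 * s / (1 + s\<^sup>2)" using s2 \<open>s > 0\<close> by (simp add: divide_simps mult.assoc)
    moreover have "2 / r\<^sup>2 = 9 / (2 * s\<^sup>2)" by (simp add: r power2_eq_square)
    ultimately have "(1 - 2 * s / (1 + s\<^sup>2)) + 2 / r\<^sup>2 < 1" by linarith
    with f g show ?thesis by blast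
  qed
qed

text \<open>At a true point \<open>y\<close> of \<open>g\<close> the conjunction reduces to
  \<open>f\<close>, so \<open>- P x y\<close> sign-represents \<open>f\<close>. This serves the case
  of constant \<open>g\<close>.\<close>

lemma approximable_less_one:
  assumes "y \<in> Y" "g y = -1" "\<exists>x\<in>X. f x = -1"
  shows "\<exists>e<1. rationally_approximable X f (2 * d) e"
proof (rule rationally_approximable_if_sign_rep[of _ _ "\<lambda>x. - P x y"])
  show "(\<lambda>x. - P x y) \<in> polynomials_le (2 * d)"
    using d_nonneg by (intro polynomials_le_mono[OF polynomials_le_uminus[OF poly_X[OF assms(1)]]]) simp
  show "f x * - P x y > 0" if "x \<in> X" for x
    using f_values[OF that] P_pos[OF that assms(1)] P_neg[OF that assms(1)] assms(2) by auto
qed (use finite_X d_nonneg f_values assms(3) in auto)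

lemma approximable_const:
  assumes "\<forall>y\<in>Y. g y = -1"
  shows "rationally_approximable Y g (2 * d) 0"
  by (rule rationally_approximableI[OF polynomials_le_const[of _ "-1"] polynomials_le_const[of _ 1]])
     (use d_nonneg assms in auto)

text \<open>A constantly true function has error 0 and the other error is below 1. Otherwise the
  dichotomy is applied in both orders: either it gives a complementary pair, or both errors are
  below 1/2.\<close>

lemma complementary_errors:
  assumes X: "\<exists>x\<in>X. f x = -1" and Y: "\<exists>y\<in>Y. g y = -1"
  shows "\<exists>e e'. e + e' < 1 \<and>
    rationally_approximable X f (2 * d) e \<and> rationally_approximable Y g (2 * d) e'"
proof -
  interpret sw: conjunction_sign_rep d Y X g f "\<lambda>y x. P x y" by (rule swap)
  consider "\<forall>y\<in>Y. g y = -1" | "\<forall>x\<in>X. f x = -1" | "\<exists>y\<in>Y. g y = 1" "\<exists>x\<in>X. f x = 1"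
    using f_values g_values by blast
  then show ?thesis
  proof cases
    case 1
    obtain e where "e < 1" "rationally_approximable X f (2 * d) e"
      using approximable_less_one X Y by blast
    with approximable_const[OF 1] show ?thesis by (intro exI[of _ e] exI[of _ 0]) simp
  next
    case 2
    obtain e where "e < 1" "rationally_approximable Y g (2 * d) e"
      using sw.approximable_less_one X Y by blast
    with sw.approximable_const[OF 2] show ?thesis by (intro exI[of _ 0] exI[of _ e]) simp
  next
    case 3
    show ?thesis
    proof (rule ccontr)
      assume neg: "\<not> ?thesis"
      then obtain e where e: "e < 1/2" "rationally_approximable X f (2 * d) e"
        using half_or_complementary_errors[OF Y 3(1)] by blast
      from neg obtain e' where e': "e' < 1/2" "rationally_approximable Y g (2 * d) e'"
        using sw.half_or_complementary_errors[OF X 3(2)] by (metis add.commute)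
      have "e + e' < 1" using e(1) e'(1) by simp
      with e e' neg show False by blast
    qed
  qed
qed

end

section \<open>Conjunctions of several functions\<close>

text \<open>Here \<open>n\<close> counts the squarings to be performed. For the least admissible
  \<open>n = m + 1\<close>, failure at \<open>m\<close> means
  \<open>2 ^ m \<le> log 2 (2 * k)\<close>, and one more doubling gives the bound.\<close>

lemma exists_double_power_two:
  assumes "k \<ge> 1"
  shows "\<exists>n. 2 * real k \<le> 2 ^ 2 ^ n \<and> 2 ^ n \<le> 2 * log 2 (2 * real k)"
proof -
  define n where "n = (LEAST n. 2 * real k \<le> 2 ^ 2 ^ n)"
  have "2 * k < 2 ^ 2 ^ (2 * k)"
    using less_exp[of "2 * k"] less_exp[of "2 ^ (2 * k)"] by linarith
  then have "real (2 * k) \<le> real (2 ^ 2 ^ (2 * k))" by (simp only: of_nat_le_iff less_imp_le)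
  then have "2 * real k \<le> 2 ^ 2 ^ (2 * k)" by simp
  then have le: "2 * real k \<le> 2 ^ 2 ^ n" unfolding n_def by (rule LeastI)
  have "2 ^ n \<le> 2 * log 2 (2 * real k)"
  proof (cases n)
    case 0
    have "log 2 2 \<le> log 2 (2 * real k)" using assms by (subst log_le_cancel_iff) auto
    with 0 show ?thesis by simp
  next
    case (Suc m)
    then have "\<not> 2 * real k \<le> 2 ^ 2 ^ m"
      using not_less_Least[of m "\<lambda>n. 2 * real k \<le> 2 ^ 2 ^ n"] by (simp add: n_def)
    then have "log 2 (2 ^ 2 ^ m) \<le> log 2 (2 * real k)" using assms by (subst log_le_cancel_iff) auto
    then show ?thesis by (simp add: Suc log_nat_power)
  qed
  with le show ?thesis by blast
qed

theorem theorem3p18: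
  fixes X :: "'k::finite \<Rightarrow> (real ^ 'n) set"
    and f :: "'k \<Rightarrow> real ^ 'n \<Rightarrow> real"
    and d :: nat and D :: real
  assumes "\<And>i. finite (X i)"
    and "\<And>i x. x \<in> X i \<Longrightarrow> f i x \<in> {-1, 1}"
    and "\<And>i. \<exists>x\<in>X i. f i x \<noteq> 1"
    and "d = threshold_degree {z. \<forall>i. z $ i \<in> X i} (conjunction f)"
    and "D = 8 * real d * log 2 (2 * real CARD('k))"
  shows "(\<Sum>i\<in>UNIV. rational_approx_error (X i) (f i) D) < 1"
proof -

  \<comment> \<open>A sign representation of minimal degree\<close>
  define Z where "Z = {z. \<forall>i. z $ i \<in> X i}"
  have "Z \<subseteq> vec_lambda ` (Pi\<^sub>E UNIV X)"
  proof
    fix z assume "z \<in> Z"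
    then show "z \<in> vec_lambda ` (Pi\<^sub>E UNIV X)"
      by (intro image_eqI[of _ _ "\<lambda>i. z $ i"]) (auto simp: Z_def)
  qed
  then have "finite Z" by (rule finite_subset) (auto intro!: finite_PiE assms(1))
  then have "\<exists>d. \<exists>p \<in> polynomials_le (real d). \<forall>z\<in>Z. conjunction f z * p z > 0"
    by (rule exists_sign_representation) (auto simp: conjunction_def)
  then have "\<exists>p \<in> polynomials_le (real d). \<forall>z\<in>Z. conjunction f z * p z > 0"
    unfolding assms(4) threshold_degree_def Z_def[symmetric] by (rule LeastI_ex)
  then obtain p where p: "p \<in> polynomials_le (real d)" "\<And>z. z \<in> Z \<Longrightarrow> conjunction f z * p z > 0"
    by blast
  have f_values: "f i x = -1 \<or> f i x = 1" if "x \<in> X i" for i x using assms(2)[OF that] by auto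
  obtain a where a: "\<And>i. a i \<in> X i" "\<And>i. f i (a i) = -1" using assms(3) f_values by metis
  have nonempty: "X i \<noteq> {}" for i using a(1)[of i] by blast
  have p_neg: "p z < 0" if "z \<in> Z" "\<And>i. f i (z $ i) = -1" for z
    using p(2)[OF that(1)] that(2) by (simp add: conjunction_def)
  have p_pos: "p z > 0" if "z \<in> Z" "f i (z $ i) = 1" for z i
  proof -
    have "\<not> (\<forall>i. f i (z $ i) = -1)" using that(2) by (metis one_neq_neg_one)
    then have "conjunction f z = 1" unfolding conjunction_def by (rule if_not_P)
    then show ?thesis using p(2)[OF that(1)] by simp
  qed

  \<comment> \<open>Errors at degree \<open>2 * d\<close>, singly and in pairs\<close>
  define R where "R i = rational_approx_error (X i) (f i) (2 * real d)" for i
  have R_less_one: "R i < 1" for i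
  proof -
    define z where "z x = (\<chi> l. if l = i then x else a l)" for x
    have z: "z x \<in> Z" if "x \<in> X i" for x using that a(1) by (simp add: z_def Z_def)
    have "\<exists>e<1. rationally_approximable (X i) (f i) (real d) e"
    proof (rule rationally_approximable_if_sign_rep)
      show "(\<lambda>x. p (z x)) \<in> polynomials_le (real d)"
        unfolding z_def by (rule polynomials_le_slice[OF p(1)])
      show "f i x * p (z x) > 0" if "x \<in> X i" for x
        using f_values[OF that]
      proof
        assume "f i x = -1"
        then have "p (z x) < 0" using a(2) by (intro p_neg z that) (simp add: z_def)
        with \<open>f i x = -1\<close> show ?thesis by simp
      next
        assume "f i x = 1"
        then have "p (z x) > 0" by (intro p_pos[of _ i] z that) (simp add: z_def)
        with \<open>f i x = 1\<close> show ?thesis by simp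
      qed
    qed (use assms(1) nonempty f_values in auto)
    then obtain e where "e < 1" "rationally_approximable (X i) (f i) (2 * real d) e"
      using rationally_approximable_mono[of _ _ "real d" _ "2 * real d"] by fastforce
    then show ?thesis
      unfolding R_def using rational_approx_error_le[OF assms(1) nonempty] by fastforce
  qed
  have R_pair: "R i + R j < 1" if "i \<noteq> j" for i j
  proof -
    define z where "z x y = (\<chi> l. if l = i then x else if l = j then y else a l)" for x y
    \<comment> \<open>For \<open>i \<noteq> j\<close> the order of the two tests is immaterial; this
      form exhibits the point as a slice in \<open>y\<close>.\<close>
    have z_swap: "z x y = (\<chi> l. if l = j then y else if l = i then x else a l)" for x y
      using that by (auto simp: z_def vec_eq_iff)
    have z: "z x y \<in> Z" if "x \<in> X i" "y \<in> X j" for x y using that a(1) by (simp add: z_def Z_def)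
    interpret conjunction_sign_rep "real d" "X i" "X j" "f i" "f j" "\<lambda>x y. - p (z x y)"
    proof
      show "(\<lambda>x. - p (z x y)) \<in> polynomials_le (real d)" for y
        unfolding z_def by (intro polynomials_le_uminus polynomials_le_slice[OF p(1)])
      show "(\<lambda>y. - p (z x y)) \<in> polynomials_le (real d)" for x
        unfolding z_swap by (intro polynomials_le_uminus polynomials_le_slice[OF p(1)])
      show "0 < - p (z x y)" if "x \<in> X i" "y \<in> X j" "f i x = -1" "f j y = -1" for x y
        using p_neg[OF z[OF that(1,2)]] that a(2) by (simp add: z_def)
      show "- p (z x y) < 0" if "x \<in> X i" "y \<in> X j" "f i x = 1 \<or> f j y = 1" for x y
        using p_pos[OF z[OF that(1,2)], of i] p_pos[OF z[OF that(1,2)], of j] that(3) \<open>i \<noteq> j\<close>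
        by (auto simp: z_def)
    qed (use assms(1) f_values in auto)
    obtain e e' where "e + e' < 1" "rationally_approximable (X i) (f i) (2 * real d) e"
      "rationally_approximable (X j) (f j) (2 * real d) e'"
      using complementary_errors a by blast
    then show ?thesis unfolding R_def
      using rational_approx_error_le[OF assms(1) nonempty] by (smt (verit))
  qed

  \<comment> \<open>Amplification by repeated squaring\<close>
  define k where "k = real CARD('k)"
  have k: "k \<ge> 1" by (simp add: k_def Suc_leI)
  obtain n where n: "2 * k \<le> 2 ^ 2 ^ n" "2 ^ n \<le> 2 * log 2 (2 * k)"
    using exists_double_power_two[of "CARD('k)"] by (auto simp: k_def Suc_leI)
  have log: "log 2 (2 * k) \<ge> 0" using k by simp
  have "2 ^ n * (2 * real d) \<le> (2 * log 2 (2 * k)) * (2 * real d)"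
    using n(2) by (intro mult_right_mono) auto
  also have "\<dots> \<le> D" using log by (simp add: assms(5) k_def[symmetric])
  finally have degree: "2 ^ n * (2 * real d) \<le> D" .
  have "1 * (2 * real d) \<le> 2 ^ n * (2 * real d)" by (intro mult_right_mono) auto
  with degree have degree': "2 * real d \<le> D" by simp
  \<comment> \<open>After \<open>n\<close> squarings the error is \<open>\<delta> ^ 2 ^ n\<close>.
    One factor \<open>\<delta>\<close> is kept; each of the other \<open>2 ^ n - 1\<close> is at
    most 1/2, and \<open>2 * k \<le> 2 ^ 2 ^ n\<close> makes their product at most
    \<open>1 / k\<close>.\<close>
  have amplified: "rational_approx_error (X i) (f i) D \<le> \<delta> / k"
    if "R i < \<delta>" "0 < \<delta>" "\<delta> \<le> 1/2" for i \<delta>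
  proof -
    obtain m where m: "2 ^ n = Suc m" by (metis not0_implies_Suc power_not_zero zero_neq_numeral)
    have "rationally_approximable (X i) (f i) (2 * real d) \<delta>"
      using that(1) assms(1) by (intro rationally_approximable_if_error_less) (auto simp: R_def)
    then have "rationally_approximable (X i) (f i) (2 ^ n * (2 * real d)) (\<delta> ^ 2 ^ n)"
      using f_values by (rule rationally_approximable_power)
    then have "rationally_approximable (X i) (f i) D (\<delta> ^ 2 ^ n)"
      by (rule rationally_approximable_mono[OF _ degree order_refl])
    then have "rational_approx_error (X i) (f i) D \<le> \<delta> ^ 2 ^ n"
      using assms(1) nonempty by (intro rational_approx_error_le)
    also have "\<dots> = \<delta> * \<delta> ^ m" by (simp add: m)
    also have "\<dots> \<le> \<delta> * (1/2) ^ m" using that by (intro mult_left_mono power_mono) auto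
    also have "\<dots> \<le> \<delta> * (1 / k)"
    proof -
      have "k \<le> 2 ^ m" using n(1) by (simp add: m)
      then have "(1/2) ^ m \<le> 1 / k" using k by (simp add: power_one_over frac_le)
      then show ?thesis using that(2) by (intro mult_left_mono) auto
    qed
    finally show ?thesis by simp
  qed
  show ?thesis
  proof (cases "\<forall>i. R i < 1/2")
    case True
    have "(\<Sum>i\<in>UNIV. rational_approx_error (X i) (f i) D) \<le> (\<Sum>i\<in>(UNIV::'k set). (1/2) / k)"
      using True by (intro sum_mono amplified) auto
    also have "\<dots> = 1/2" using k by (simp add: k_def)
    finally show ?thesis by simp
  next
    case False
    then obtain i where i: "R i \<ge> 1/2" by (meson not_less)
    \<comment> \<open>By \<open>R_pair\<close> all other errors are below \<open>\<delta>\<close>,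
      so amplification brings each to at most \<open>\<delta> / k\<close>. The total is then at most
      \<open>(1 - \<delta>) + (k - 1) * (\<delta> / k)\<close>, which is less than 1.\<close>
    define \<delta> where "\<delta> = 1 - R i"
    have \<delta>: "0 < \<delta>" "\<delta> \<le> 1/2" using i R_less_one[of i] by (auto simp: \<delta>_def)
    have "rational_approx_error (X i) (f i) D \<le> R i"
    \<comment> \<open>The infimum \<open>R i\<close> may not be attained, so witnesses exist only
      for errors \<open>R i + e\<close>.\<close>
    proof (rule field_le_epsilon)
      fix e :: real assume "e > 0"
      then have "rationally_approximable (X i) (f i) (2 * real d) (R i + e)"
        using assms(1) by (intro rationally_approximable_if_error_less) (auto simp: R_def)
      then have "rationally_approximable (X i) (f i) D (R i + e)"
        by (rule rationally_approximable_mono[OF _ degree' order_refl])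
      then show "rational_approx_error (X i) (f i) D \<le> R i + e"
        using assms(1) nonempty by (intro rational_approx_error_le)
    qed
    moreover have "(\<Sum>j\<in>UNIV - {i}. rational_approx_error (X j) (f j) D) \<le> (\<Sum>j\<in>UNIV - {i}. \<delta> / k)"
    proof (intro sum_mono amplified \<delta>)
      fix j assume "j \<in> UNIV - {i}"
      then show "R j < \<delta>" using R_pair[of i j] by (simp add: \<delta>_def)
    qed
    moreover have "(\<Sum>j\<in>UNIV - {i}. \<delta> / k) = (k - 1) * (\<delta> / k)"
      by (simp add: k_def card_Diff_singleton of_nat_diff Suc_leI)
    moreover have "(k - 1) * (\<delta> / k) < \<delta>" using k \<delta> by (simp add: field_simps)
    moreover have "(\<Sum>j\<in>UNIV. rational_approx_error (X j) (f j) D)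
        = rational_approx_error (X i) (f i) D + (\<Sum>j\<in>UNIV - {i}. rational_approx_error (X j) (f j) D)"
      by (rule sum.remove) auto
    ultimately show ?thesis unfolding \<delta>_def by linarith
  qed
qed

end
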